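(* Let $s$ be an even integer, let $t$ be any integer, and let $n$ be a non-negative integer. Then $$\sum_{k=0}^n \binom{n}{k} \frac{1}{k+1} (-1)^{k} L_s^{n-k} F_{s(n+k+2)+t} = \frac{1}{n+1}\Big( L_s^{n+1} F_{s(n+1)+t} - F_t \Big)$$ and $$\sum_{k=0}^n \binom{n}{k} \frac{1}{k+1} (-1)^{k} L_s^{n-k} L_{s(n+k+2)+t} = \frac{1}{n+1}\Big( L_s^{n+1} L_{s(n+1)+t} - L_t \Big).$$
   Context: $F_m$ and $L_m$ denote the Fibonacci and Lucas numbers, defined for all integers $m$ by the recurrence $x_m = x_{m-1}+x_{m-2}$ with $F_0=0$, $F_1=1$ and $L_0=2$, $L_1=1$. In particular $F_{-m}=(-1)^{m-1}F_m$ and $L_{-m}=(-1)^m L_m$. *)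

theory Defs
  imports Complex_Main "HOL-Number_Theory.Fib"
begin

text \<open>
  Fibonacci and Lucas numbers at all integer indices. Negative indices are reached by
  reading the recurrence backwards, as \<open>x\<^bsub>m\<^esub> = x\<^bsub>m+2\<^esub> - x\<^bsub>m+1\<^esub>\<close>.
\<close>

function fibZ :: "int \<Rightarrow> int" where
  "fibZ m =
     (if m = 0 then 0
      else if m = 1 then 1
      else if m > 1 then fibZ (m - 1) + fibZ (m - 2)
      else fibZ (m + 2) - fibZ (m + 1))"
  by pat_completeness auto
termination by (relation "measure (\<lambda>m. nat \<bar>2 * m - 1\<bar>)") auto

function lucasZ :: "int \<Rightarrow> int" where
  "lucasZ m =
     (if m = 0 then 2
      else if m = 1 then 1
      else if m > 1 then lucasZ (m - 1) + lucasZ (m - 2)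
      else lucasZ (m + 2) - lucasZ (m + 1))"
  by pat_completeness auto
termination by (relation "measure (\<lambda>m. nat \<bar>2 * m - 1\<bar>)") auto

declare fibZ.simps [simp del] lucasZ.simps [simp del]

lemma fibZ_0 [simp]: "fibZ 0 = 0" and fibZ_1 [simp]: "fibZ 1 = 1"
  by (simp_all add: fibZ.simps)

lemma lucasZ_0 [simp]: "lucasZ 0 = 2" and lucasZ_1 [simp]: "lucasZ 1 = 1"
  by (simp_all add: lucasZ.simps)

lemma fibZ_rec: "fibZ m = fibZ (m - 1) + fibZ (m - 2)"
proof (cases "m > 1")
  case True
  then show ?thesis by (subst fibZ.simps) simp
next
  case False
  then have "fibZ (m - 2) = fibZ m - fibZ (m - 1)"
    by (subst fibZ.simps) simp
  then show ?thesis by simp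
qed

lemma lucasZ_rec: "lucasZ m = lucasZ (m - 1) + lucasZ (m - 2)"
proof (cases "m > 1")
  case True
  then show ?thesis by (subst lucasZ.simps) simp
next
  case False
  then have "lucasZ (m - 2) = lucasZ m - lucasZ (m - 1)"
    by (subst lucasZ.simps) simp
  then show ?thesis by simp
qed

lemma fibZ_of_nat: "fibZ (int n) = int (fib n)"
proof (induction n rule: fib.induct)
  case (3 n)
  have "fibZ (int (Suc (Suc n))) = fibZ (int (Suc n)) + fibZ (int n)"
    by (subst fibZ_rec) (simp add: algebra_simps)
  with 3 show ?case by simp
qed simp_all

lemma fibZ_uminus_of_nat: "fibZ (- int n) = - ((-1) ^ n * fibZ (int n))"
proof (induction n rule: fib.induct)
  case 2
  show ?case using fibZ_rec[of 1] by (simp add: fibZ.simps)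
next
  case (3 n)
  have "fibZ (- int (Suc (Suc n))) = fibZ (- int n) - fibZ (- int (Suc n))"
  proof -
    have "- int (Suc n) = - int n - 1" "- int (Suc (Suc n)) = - int n - 2" by simp_all
    then show ?thesis using fibZ_rec[of "- int n"] by (simp only:)
  qed
  moreover have "fibZ (int (Suc (Suc n))) = fibZ (int (Suc n)) + fibZ (int n)"
    by (subst fibZ_rec) (simp add: algebra_simps)
  ultimately show ?case using 3 by (simp add: algebra_simps)
qed simp

lemma lucasZ_uminus_of_nat: "lucasZ (- int n) = (-1) ^ n * lucasZ (int n)"
proof (induction n rule: fib.induct)
  case 2
  show ?case by (simp add: lucasZ.simps)
next
  case (3 n)
  have "lucasZ (- int (Suc (Suc n))) = lucasZ (- int n) - lucasZ (- int (Suc n))"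
  proof -
    have "- int (Suc n) = - int n - 1" "- int (Suc (Suc n)) = - int n - 2" by simp_all
    then show ?thesis using lucasZ_rec[of "- int n"] by (simp only:)
  qed
  moreover have "lucasZ (int (Suc (Suc n))) = lucasZ (int (Suc n)) + lucasZ (int n)"
    by (subst lucasZ_rec) (simp add: algebra_simps)
  ultimately show ?case using 3 by (simp add: algebra_simps)
qed simp

end

theory Submission
  imports Defs
begin

text \<open>
  Both \<open>fibZ\<close> and \<open>lucasZ\<close>, read along multiples of an even \<open>s\<close>, solve
  \<open>a\<^bsub>i\<^esub> = L\<^bsub>s\<^esub> a\<^bsub>i+1\<^esub> - a\<^bsub>i+2\<^esub>\<close>, so the operator \<open>(L\<^bsub>s\<^esub> - E) E\<close>, with \<open>E\<close> the shift, fixes them.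
  Expanding its \<open>(n+1)\<close>-st power binomially gives \<open>a\<^bsub>0\<^esub>\<close>; isolating the term of index \<open>0\<close> and
  absorbing \<open>1/(k+1)\<close> into the binomial coefficient yields the identity.
\<close>

text \<open>For fixed \<open>m\<close>, each of \<open>G (m + int k)\<close> and
  \<open>(-1) ^ k * G (m - int k)\<close> obeys the Fibonacci recurrence in \<open>k\<close>: the
  alternating sign compensates for running \<open>G\<close> backwards. A two-step induction thus
  needs only \<open>k = 0\<close> and \<open>k = 1\<close>.\<close>

lemma lucasZ_mult_recurrence:
  fixes G :: "int \<Rightarrow> int"
  assumes G: "\<And>m. G m = G (m - 1) + G (m - 2)"
  shows "lucasZ (int k) * G m = G (m + int k) + (-1) ^ k * G (m - int k)"
proof (induction k arbitrary: m rule: fib.induct)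
  case 2
  show ?case using G[of "m + 1"] by simp
next
  case (3 k)
  have "lucasZ (int (Suc (Suc k))) = lucasZ (int (Suc k)) + lucasZ (int k)"
    by (subst lucasZ_rec) (simp add: algebra_simps)
  moreover have "G (m + int (Suc (Suc k))) = G (m + int (Suc k)) + G (m + int k)"
    by (subst G) (simp add: algebra_simps)
  moreover have "G (m - int k) = G (m - int (Suc k)) + G (m - int (Suc (Suc k)))"
    by (subst G) (simp add: algebra_simps)
  ultimately show ?case
    using 3[of m] by (simp add: algebra_simps)
qed simp

text \<open>Evenness removes the sign; negative \<open>s\<close> reduces to positive because
  \<open>lucasZ (- s) = lucasZ s\<close> for even \<open>s\<close> and the right-hand side is
  symmetric in \<open>s\<close>.\<close>

lemma lucasZ_mult_recurrence_even:
  fixes G :: "int \<Rightarrow> int"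
  assumes G: "\<And>m. G m = G (m - 1) + G (m - 2)" and "even s"
  shows "lucasZ s * G m = G (m + s) + G (m - s)"
proof (cases "s \<ge> 0")
  case True
  then obtain k where k: "s = int k" using nonneg_int_cases by blast
  then show ?thesis
    using \<open>even s\<close> lucasZ_mult_recurrence[OF G, of k m] by simp
next
  case False
  then obtain k where k: "s = - int k" by (metis int_cases2 of_nat_0_le_iff)
  then show ?thesis
    using \<open>even s\<close> lucasZ_mult_recurrence[OF G, of k m] lucasZ_uminus_of_nat[of k] by simp
qed

text \<open>Peels one factor \<open>c - E\<close> off its \<open>Suc n\<close>-th power, by Pascal's
  rule.\<close>

lemma binomial_sum_Suc:
  fixes c :: "'a::comm_ring_1" and b :: "nat \<Rightarrow> 'a"
  shows "(\<Sum>j\<le>Suc n. of_nat (Suc n choose j) * (-1) ^ j * c ^ (Suc n - j) * b j)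
       = (\<Sum>j\<le>n. of_nat (n choose j) * (-1) ^ j * c ^ (n - j) * (c * b j - b (Suc j)))"
proof -
  let ?f = "\<lambda>j. of_nat (n choose j) * (-1) ^ j * c ^ (Suc n - j) * b j"
  have "(\<Sum>j\<le>Suc n. of_nat (Suc n choose j) * (-1) ^ j * c ^ (Suc n - j) * b j)
      = ?f 0 + (\<Sum>j\<le>n. ?f (Suc j))
        - (\<Sum>j\<le>n. of_nat (n choose j) * (-1) ^ j * c ^ (n - j) * b (Suc j))"
    by (subst sum.atMost_Suc_shift) (simp add: algebra_simps sum.distrib sum_negf sum_subtractf)
  also have "?f 0 + (\<Sum>j\<le>n. ?f (Suc j)) = (\<Sum>j\<le>Suc n. ?f j)"
    by (rule sum.atMost_Suc_shift [symmetric])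
  \<comment> \<open>The top term vanishes since \<open>n choose Suc n = 0\<close>; every other term
    releases one factor \<open>c\<close>.\<close>
  also have "\<dots> = (\<Sum>j\<le>n. of_nat (n choose j) * (-1) ^ j * c ^ (n - j) * (c * b j))"
    by (simp add: Suc_diff_le binomial_eq_0 mult_ac)
  finally show ?thesis
    by (simp add: right_diff_distrib sum_subtractf)
qed

text \<open>Peeling with \<open>b j = a (Suc n + j)\<close> turns \<open>c * b j - b (Suc j)\<close>
  into \<open>a (n + j)\<close>, which is the sum for \<open>n\<close>.\<close>

lemma binomial_sum_recurrence:
  fixes c :: "'a::comm_ring_1" and a :: "nat \<Rightarrow> 'a"
  assumes "\<And>i. c * a (Suc i) - a (Suc (Suc i)) = a i"
  shows "(\<Sum>j\<le>n. of_nat (n choose j) * (-1) ^ j * c ^ (n - j) * a (n + j)) = a 0"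
proof (induction n)
  case (Suc n)
  then show ?case
    by (subst binomial_sum_Suc) (simp add: assms)
qed simp

lemma binomial_harmonic_sum_recurrence:
  fixes c :: "'a::field_char_0" and a :: "nat \<Rightarrow> 'a"
  assumes "\<And>i. c * a (Suc i) - a (Suc (Suc i)) = a i"
  shows "(\<Sum>k=0..n. of_nat (n choose k) * (1 / (of_nat k + 1)) * (-1) ^ k * c ^ (n - k) * a (n + k + 2))
       = 1 / (of_nat n + 1) * (c ^ (n + 1) * a (n + 1) - a 0)"
proof -
  \<comment> \<open>The summand of the preceding lemma at \<open>Suc n\<close>. The shift
    \<open>j = k + 1\<close> explains the offset in \<open>a (n + k + 2)\<close> and costs one
    sign.\<close>
  let ?g = "\<lambda>j. of_nat (Suc n choose j) * (-1) ^ j * c ^ (Suc n - j) * a (Suc n + j)"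
  have summand: "of_nat (n choose k) * (1 / (of_nat k + 1)) * (-1) ^ k * c ^ (n - k) * a (n + k + 2)
      = - (1 / (of_nat n + 1)) * ?g (Suc k)" for k
  proof -
    have "of_nat (Suc k) * of_nat (Suc n choose Suc k) = (of_nat (Suc n) * of_nat (n choose k) :: 'a)"
      by (metis Suc_times_binomial_eq mult.commute of_nat_mult)
    moreover have "of_nat (Suc k) \<noteq> (0::'a)" "of_nat (Suc n) \<noteq> (0::'a)"
      by (simp_all only: of_nat_eq_0_iff)
    ultimately have "of_nat (n choose k) * (1 / (of_nat k + 1))
        = 1 / (of_nat n + 1) * (of_nat (Suc n choose Suc k) :: 'a)"
      by (simp add: field_simps del: binomial_Suc_Suc)
    then show ?thesis
      by (simp del: binomial_Suc_Suc)
  qed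
  have "?g 0 + (\<Sum>k\<le>n. ?g (Suc k)) = a 0"
    using binomial_sum_recurrence[of c a "Suc n", OF assms]
    by (subst (asm) sum.atMost_Suc_shift)
  \<comment> \<open>Here \<open>?g 0\<close> is \<open>c ^ (n + 1) * a (n + 1)\<close>; the outer
    minus is kept to cancel the one in \<open>summand\<close>.\<close>
  then have "(\<Sum>k\<le>n. ?g (Suc k)) = - (c ^ (n + 1) * a (n + 1) - a 0)"
    by (simp add: algebra_simps)
  then show ?thesis
    unfolding summand atLeast0AtMost sum_distrib_left [symmetric] by (simp only: minus_mult_minus)
qed

text \<open>Stated for any solution \<open>G\<close> of the recurrence, so that both identities are
  instances.\<close>

lemma binomial_harmonic_sum_fibonacci_like:
  fixes G :: "int \<Rightarrow> int" and s t :: int and n :: nat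
  assumes G: "\<And>m. G m = G (m - 1) + G (m - 2)" and "even s"
  shows "(\<Sum>k=0..n. real (n choose k) * (1 / (real k + 1)) * (-1) ^ k
            * real_of_int (lucasZ s) ^ (n - k) * real_of_int (G (s * (int n + int k + 2) + t)))
       = 1 / (real n + 1)
            * (real_of_int (lucasZ s) ^ (n + 1) * real_of_int (G (s * (int n + 1) + t))
               - real_of_int (G t))"
proof -
  define a where "a i = real_of_int (G (s * int i + t))" for i
  have "real_of_int (lucasZ s) * a (Suc i) - a (Suc (Suc i)) = a i" for i
  proof -
    have "lucasZ s * G (s * int (Suc i) + t) = G (s * int (Suc (Suc i)) + t) + G (s * int i + t)"
      using lucasZ_mult_recurrence_even[OF assms, of "s * int (Suc i) + t"]
      by (simp add: algebra_simps)
    then show ?thesis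
      unfolding a_def by (metis add_diff_cancel_left' of_int_add of_int_mult)
  qed
  from binomial_harmonic_sum_recurrence[of "real_of_int (lucasZ s)" a n, OF this] show ?thesis
    by (simp add: a_def add_ac)
qed

theorem theorem10:
  fixes s t :: int and n :: nat
  assumes "even s"
  shows "((\<Sum>k=0..n. real (n choose k) * (1 / (real k + 1)) * (-1) ^ k
            * real_of_int (lucasZ s) ^ (n - k)
            * real_of_int (fibZ (s * (int n + int k + 2) + t)))
         = 1 / (real n + 1)
            * (real_of_int (lucasZ s) ^ (n + 1) * real_of_int (fibZ (s * (int n + 1) + t))
               - real_of_int (fibZ t)))
    \<and> ((\<Sum>k=0..n. real (n choose k) * (1 / (real k + 1)) * (-1) ^ k
            * real_of_int (lucasZ s) ^ (n - k)
            * real_of_int (lucasZ (s * (int n + int k + 2) + t)))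
         = 1 / (real n + 1)
            * (real_of_int (lucasZ s) ^ (n + 1) * real_of_int (lucasZ (s * (int n + 1) + t))
               - real_of_int (lucasZ t)))"
  using binomial_harmonic_sum_fibonacci_like[OF fibZ_rec assms]
    binomial_harmonic_sum_fibonacci_like[OF lucasZ_rec assms]
  by (intro conjI)

end
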